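(* Let $q$ be a prime power and $n$ a positive integer. Both the minimum distance and the stopping distance of the binary code $\mathcal{C}(n,q)$ (with respect to the parity-check matrix $H(n,q)$) are at least $\frac{2(q^n-1)}{q-1}$.
   Context: $\mathbb{S}_n(\mathbb{F}_q)$ denotes the set of $n\times n$ symmetric matrices over $\mathbb{F}_q$ (its elements are called points). Two points $S,S'$ are adjacent if $\operatorname{rank}(S-S')=1$. A line is a maximal set of rank $1$: a subset $\mathcal{M}\subseteq\mathbb{S}_n(\mathbb{F}_q)$ such that any two distinct points of $\mathcal{M}$ are adjacent and no point of $\mathbb{S}_n(\mathbb{F}_q)\setminus\mathcal{M}$ is adjacent to every point of $\mathcal{M}$. $H(n,q)$ is the binary matrix with rows indexed by the lines and columns indexed by the points, whose (line, point) entry is $1$ iff the point belongs to the line. $\mathcal{C}(n,q)=\{c\in\mathbb{F}_2^{\text{points}}: H(n,q)c=0\}$. For a binary code given as the null space of a parity-check matrix $H$, a stopping set is a set $T$ of coordinate positions such that no row of $H$ has exactly one $1$ among the positions in $T$; the stopping distance is the minimum size of a nonempty stopping set. *)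

theory Defs
  imports "HOL-Analysis.Analysis" "HOL-Library.Z2"
begin

definition null_space_code :: "'r set \<Rightarrow> 'c set \<Rightarrow> ('r \<Rightarrow> 'c \<Rightarrow> bit) \<Rightarrow> ('c \<Rightarrow> bit) set" where
  "null_space_code R P H = {c \<in> P \<rightarrow>\<^sub>E UNIV. \<forall>r\<in>R. (\<Sum>p\<in>P. H r p * c p) = 0}"

definition hamming_distance :: "'c set \<Rightarrow> ('c \<Rightarrow> bit) \<Rightarrow> ('c \<Rightarrow> bit) \<Rightarrow> nat" where
  "hamming_distance P c d = card {p \<in> P. c p \<noteq> d p}"

text \<open>The infimum is taken in \<^typ>\<open>enat\<close>: it is an attained minimum whenever the set is nonempty,
  and it is \<open>\<infinity>\<close> if the code has only one codeword.\<close>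

definition minimum_distance :: "'c set \<Rightarrow> ('c \<Rightarrow> bit) set \<Rightarrow> enat" where
  "minimum_distance P C =
    Inf {enat (hamming_distance P c d) | c d. c \<in> C \<and> d \<in> C \<and> c \<noteq> d}"

definition stopping_set :: "'r set \<Rightarrow> 'c set \<Rightarrow> ('r \<Rightarrow> 'c \<Rightarrow> bit) \<Rightarrow> 'c set \<Rightarrow> bool" where
  "stopping_set R P H T \<longleftrightarrow> T \<subseteq> P \<and> (\<forall>r\<in>R. card {p \<in> T. H r p = 1} \<noteq> 1)"

definition stopping_distance :: "'r set \<Rightarrow> 'c set \<Rightarrow> ('r \<Rightarrow> 'c \<Rightarrow> bit) \<Rightarrow> enat" where
  "stopping_distance R P H = Inf {enat (card T) | T. stopping_set R P H T \<and> T \<noteq> {}}"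

text \<open>The field with \<open>q\<close> elements is a type \<open>'a\<close> of classes \<open>field\<close> and \<open>finite\<close> with
  \<open>CARD('a) = q\<close>; matrix rows and columns are indexed by a type \<open>'n\<close> with \<open>CARD('n) = n\<close>.\<close>

definition points :: "('a::{field,finite} ^ 'n::finite ^ 'n) set" where
  "points = {S. transpose S = S}"

definition adjacent :: "'a::{field,finite} ^ 'n::finite ^ 'n \<Rightarrow> 'a ^ 'n ^ 'n \<Rightarrow> bool" where
  "adjacent S S' \<longleftrightarrow> rank (S - S') = 1"

definition lines :: "('a::{field,finite} ^ 'n::finite ^ 'n) set set" where
  "lines = {M. M \<subseteq> points \<and> pairwise adjacent M \<and>
               \<not> (\<exists>S \<in> points - M. \<forall>S' \<in> M. adjacent S S')}"

definition incidence :: "('a::{field,finite} ^ 'n::finite ^ 'n) set \<Rightarrow> 'a ^ 'n ^ 'n \<Rightarrow> bit" where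
  "incidence M S = (if S \<in> M then 1 else 0)"

definition symmetric_code :: "('a::{field,finite} ^ 'n::finite ^ 'n \<Rightarrow> bit) set" where
  "symmetric_code = null_space_code lines points incidence"

end

theory Submission
  imports Defs
begin

text \<open>The lines are the sets \<open>{S + c x x\<^sup>T | c}\<close> with \<open>x \<noteq> 0\<close>, and a nonempty stopping set \<open>T\<close>
  through \<open>S\<close> meets each of the \<open>N = (q\<^sup>n - 1) / (q - 1)\<close> lines on \<open>S\<close> in another point.
  So it has two adjacent points \<open>S\<close> and \<open>S'\<close>, and the remaining \<open>N - 1\<close> lines on each of them
  contribute further points of \<open>T\<close>.  These are all distinct: pairwise adjacent points are collinear,
  so no point off the line \<open>SS'\<close> is adjacent to both.  Hence \<open>T\<close> has at least \<open>2N\<close> elements.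
  The support of the difference of two codewords is a stopping set, which gives the bound for the
  minimum distance.\<close>

section \<open>Symmetric matrices of rank one\<close>

definition sym_outer :: "'a::field \<Rightarrow> 'a ^ 'n \<Rightarrow> 'a ^ 'n ^ 'n" where
  "sym_outer c x = (\<chi> i j. c * x $ i * x $ j)"

lemma sym_outer_nth [simp]: "sym_outer c x $ i $ j = c * x $ i * x $ j"
  by (simp add: sym_outer_def)

lemma sym_outer_diff: "sym_outer c x - sym_outer d x = sym_outer (c - d) x"
  by (simp add: vec_eq_iff algebra_simps)

lemma sym_outer_uminus: "sym_outer (- c) x = - sym_outer c x"
  by (simp add: vec_eq_iff)

lemma sym_outer_zero [simp]: "sym_outer 0 x = 0"
  by (simp add: vec_eq_iff)

lemma sym_outer_eq_0_iff:
  fixes x :: "'a::field ^ 'n"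
  assumes "x \<noteq> 0"
  shows "sym_outer c x = 0 \<longleftrightarrow> c = 0"
proof
  obtain i where "x $ i \<noteq> 0" using assms by (auto simp: vec_eq_iff)
  moreover assume "sym_outer c x = 0"
  then have "sym_outer c x $ i $ i = 0" by simp
  ultimately show "c = 0" by simp
qed simp

text \<open>Rescaling the direction changes the scalar only by a square. This is why
  \<open>sym_outer\<close> carries a scalar: the field may contain non-squares.\<close>

lemma sym_outer_scale: "sym_outer c (k *s x) = sym_outer (c * k\<^sup>2) x"
  by (simp add: vec_eq_iff power2_eq_square algebra_simps)

lemma rank_sym_outer:
  fixes x :: "'a::field ^ 'n"
  assumes "c \<noteq> 0" "x \<noteq> 0"
  shows "rank (sym_outer c x) = 1"
proof -
  obtain k where k: "x $ k \<noteq> 0" using assms by (auto simp: vec_eq_iff)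
  have row: "row i (sym_outer c x) = (c * x $ i) *s x" for i
    by (simp add: vec_eq_iff row_def)
  have "rows (sym_outer c x) \<subseteq> vec.span {x}"
    by (auto simp: rows_def row intro: vec.span_scale vec.span_base)
  moreover have "{x} \<subseteq> vec.span (rows (sym_outer c x))"
  proof -
    have "x = inverse (c * x $ k) *s row k (sym_outer c x)"
      unfolding row vec.scale_scale using k assms by (subst left_inverse) auto
    then have "x \<in> vec.span (rows (sym_outer c x))"
      by (metis (mono_tags, lifting) UNIV_I mem_Collect_eq rows_def vec.span_base vec.span_scale)
    then show ?thesis by simp
  qed
  ultimately have "vec.span (rows (sym_outer c x)) = vec.span {x}"
    by (simp add: vec.span_eq)
  then have "vec.dim (rows (sym_outer c x)) = vec.dim {x}"
    by (metis vec.dim_span)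
  then show ?thesis using assms by (simp add: row_rank_def_gen)
qed

text \<open>All rows are multiples \<open>u i *s v\<close> of one vector \<open>v\<close>, and
  symmetry of the entries \<open>u i * v $ j\<close> forces \<open>u\<close> to be proportional to
  \<open>v\<close>.\<close>

lemma symmetric_rank_1E:
  fixes A :: "'a::field ^ 'n::finite ^ 'n"
  assumes "rank A = 1" "transpose A = A"
  obtains c x where "c \<noteq> 0" "x \<noteq> 0" "A = sym_outer c x"
proof -
  obtain B where B: "B \<subseteq> rows A" "vec.independent B" "rows A \<subseteq> vec.span B"
    "card B = vec.dim (rows A)"
    using vec.basis_exists by blast
  have "card B = 1" using assms(1) B(4) by (simp add: row_rank_def_gen)
  then obtain v where v: "B = {v}" by (auto simp: card_1_singleton_iff)
  have "\<exists>k. row i A = k *s v" for i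
    using B(3) by (auto simp: v rows_def vec.span_singleton)
  then obtain u where "row i A = u i *s v" for i by metis
  then have u: "A $ i $ j = u i * v $ j" for i j
    by (metis row_def vec_lambda_eta vector_smult_component)
  have sym: "u i * v $ j = u j * v $ i" for i j
    using assms(2) by (metis u transpose_def vec_lambda_beta)
  have "v \<noteq> 0" using B(2) v vec.dependent_zero by blast
  then obtain j where j: "v $ j \<noteq> 0" by (auto simp: vec_eq_iff)
  have uv: "u i = (u j / v $ j) * v $ i" for i
    using sym[of i j] j by (simp add: field_simps)
  have "A $ i $ l = sym_outer (u j / v $ j) v $ i $ l" for i l
    unfolding u sym_outer_nth by (subst uv) simp
  then have "A = sym_outer (u j / v $ j) v" by (simp only: vec_eq_iff) simp
  moreover have "u j / v $ j \<noteq> 0"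
  proof
    assume "u j / v $ j = 0"
    with calculation have "A = 0" by (metis sym_outer_zero)
    then have "rows A \<subseteq> {0}" by (auto simp: rows_def row_def vec_eq_iff)
    \<comment> \<open>The basis vector \<open>v\<close> was chosen among the rows of
      \<open>A\<close>, so these cannot all vanish.\<close>
    then show False using B(1) v \<open>v \<noteq> 0\<close> by auto
  qed
  ultimately show thesis using that \<open>v \<noteq> 0\<close> by blast
qed

text \<open>The \<open>2 \<times> 2\<close> minor of \<open>b y y\<^sup>T - a x x\<^sup>T\<close> with rows and columns \<open>i\<close>, \<open>j\<close> equals
  \<open>- a b (x\<^sub>i y\<^sub>j - x\<^sub>j y\<^sub>i)\<^sup>2\<close>.\<close>

lemma sym_outer_diff_eq_sym_outer:
  fixes x y z :: "'a::field ^ 'n"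
  assumes eq: "sym_outer b y - sym_outer a x = sym_outer e z"
    and "a \<noteq> 0" "b \<noteq> 0" "x \<noteq> 0"
  obtains k where "y = k *s x"
proof -
  have minors: "x $ i * y $ j = x $ j * y $ i" for i j
  proof -
    have m: "e * z $ r * z $ s = b * y $ r * y $ s - a * x $ r * x $ s" for r s
      using arg_cong[OF eq, of "\<lambda>M. M $ r $ s"] by simp
    have "- (a * b * (x $ i * y $ j - x $ j * y $ i)\<^sup>2) =
      (b * y $ i * y $ i - a * x $ i * x $ i) * (b * y $ j * y $ j - a * x $ j * x $ j) -
      (b * y $ i * y $ j - a * x $ i * x $ j) * (b * y $ j * y $ i - a * x $ j * x $ i)"
      by algebra
    \<comment> \<open>By \<open>m\<close> this is a minor of \<open>sym_outer e z\<close>, and all 2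
      by 2 minors of that matrix vanish.\<close>
    also have "\<dots> = 0" by (simp flip: m)
    finally show ?thesis using assms by simp
  qed
  obtain i where i: "x $ i \<noteq> 0" using \<open>x \<noteq> 0\<close> by (auto simp: vec_eq_iff)
  have "y = (y $ i / x $ i) *s x"
    using i minors[of i] by (simp add: vec_eq_iff field_simps)
  then show thesis using that by blast
qed

section \<open>Lines and points of a stopping set\<close>

lemma adjacent_add_sym_outer:
  fixes S :: "'a::{field,finite} ^ 'n::finite ^ 'n"
  assumes "c \<noteq> d" "x \<noteq> 0"
  shows "adjacent (S + sym_outer c x) (S + sym_outer d x)"
  using assms by (simp add: adjacent_def sym_outer_diff rank_sym_outer)

lemma line_in_lines:
  fixes S :: "'a::{field,finite} ^ 'n::finite ^ 'n"
  assumes S: "S \<in> points" and x: "x \<noteq> 0"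
  shows "range (\<lambda>c. S + sym_outer c x) \<in> lines"
proof -
  let ?L = "range (\<lambda>c. S + sym_outer c x)"
  have sub: "?L \<subseteq> points"
    using S by (auto simp: points_def vec_eq_iff transpose_def algebra_simps)
  have "P \<in> ?L" if P: "P \<in> points" and adj: "\<forall>Q\<in>?L. adjacent P Q" for P
  proof -
    have rk: "rank (P - (S + sym_outer c x)) = 1" for c
      using adj by (auto simp: adjacent_def)
    have sym: "transpose (P - (S + sym_outer c x)) = P - (S + sym_outer c x)" for c
      using P S by (simp add: points_def vec_eq_iff transpose_def algebra_simps)
    \<comment> \<open>For maximality it suffices to use two points of the line, \<open>c = 0\<close>
      and \<open>c = 1\<close>: adjacency of \<open>P\<close> to both already makes its direction
      \<open>y\<close> from \<open>S\<close> proportional to \<open>x\<close>.\<close>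
    obtain b y where y: "b \<noteq> 0" "P - (S + sym_outer 0 x) = sym_outer b y"
      using symmetric_rank_1E[OF rk sym] by metis
    obtain e z where "P - (S + sym_outer 1 x) = sym_outer e z"
      using symmetric_rank_1E[OF rk sym] by metis
    with y have "sym_outer b y - sym_outer 1 x = sym_outer e z"
      by (simp add: algebra_simps)
    then obtain k where "y = k *s x"
      using sym_outer_diff_eq_sym_outer y(1) x by (metis zero_neq_one)
    with y have "P = S + sym_outer (b * k\<^sup>2) x"
      by (simp add: sym_outer_scale algebra_simps)
    then show ?thesis by blast
  qed
  moreover have "pairwise adjacent ?L"
    by (auto simp: pairwise_def) (metis adjacent_add_sym_outer x)
  ultimately show ?thesis using sub unfolding lines_def by blast
qed

text \<open>The line through \<open>S\<close> in direction \<open>x\<close> contains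
  \<open>S\<close> as its point \<open>c = 0\<close>, and a stopping set cannot meet a line in that
  point alone.\<close>

lemma stopping_set_meets_line:
  fixes S :: "'a::{field,finite} ^ 'n::finite ^ 'n"
  assumes T: "stopping_set lines points incidence T" and S: "S \<in> T" and x: "x \<noteq> 0"
  shows "\<exists>c. c \<noteq> 0 \<and> S + sym_outer c x \<in> T"
proof -
  let ?L = "range (\<lambda>c. S + sym_outer c x)"
  have "S \<in> points" using T S by (auto simp: stopping_set_def)
  then have "card {p \<in> T. incidence ?L p = 1} \<noteq> 1"
    using T line_in_lines[OF _ x] unfolding stopping_set_def by blast
  moreover have "{p \<in> T. incidence ?L p = 1} = T \<inter> ?L"
    by (auto simp: incidence_def)
  moreover have "S \<in> T \<inter> ?L" using S by (auto intro: image_eqI[of _ _ 0])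
  ultimately have "T \<inter> ?L \<noteq> {S}" "S \<in> T \<inter> ?L" by auto
  then obtain p where "p \<in> T \<inter> ?L" "p \<noteq> S" by blast
  then obtain c where c: "p = S + sym_outer c x" "p \<in> T" by blast
  with \<open>p \<noteq> S\<close> have "c \<noteq> 0" by auto
  with c show ?thesis by blast
qed

text \<open>The neighbours of \<open>S\<close> in \<open>T\<close> outside the line through
  \<open>S\<close> in direction \<open>u\<close>. The excluded range contains 0, so \<open>x\<close>
  is nonzero.\<close>

definition off_line :: "('a::field ^ 'n ^ 'n) set \<Rightarrow> 'a ^ 'n ^ 'n \<Rightarrow> 'a ^ 'n \<Rightarrow> ('a ^ 'n ^ 'n) set" where
  "off_line T S u = {P \<in> T. \<exists>c x. c \<noteq> 0 \<and> x \<notin> range (\<lambda>k. k *s u) \<and> P = S + sym_outer c x}"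

text \<open>Directions are counted as vectors: each of the at least \<open>q^n - q\<close> vectors
  outside the span of \<open>u\<close> yields a point, and one point comes from at most
  \<open>q - 1\<close> vectors, the nonzero multiples of one of them. So there are at least
  \<open>(q^n - q) / (q - 1) = N - 1\<close> points.\<close>

lemma card_off_line:
  fixes S :: "'a::{field,finite} ^ 'n::finite ^ 'n"
  assumes T: "stopping_set lines points incidence T" and S: "S \<in> T" and u: "u \<noteq> 0"
  shows "CARD('a) ^ CARD('n) \<le> CARD('a) + (CARD('a) - 1) * card (off_line T S u)"
proof -
  let ?R = "range (\<lambda>k. k *s u)" and ?q = "CARD('a)"
  have nz: "x \<noteq> 0" if "x \<notin> ?R" for x
    using that by (metis rangeI vec.scale_zero_left)
  have "\<exists>c. c \<noteq> 0 \<and> S + sym_outer c x \<in> T" if "x \<notin> ?R" for x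
    using stopping_set_meets_line[OF T S nz[OF that]] .
  then obtain f where f: "f x \<noteq> 0" "S + sym_outer (f x) x \<in> T" if "x \<notin> ?R" for x
    by metis
  define g where "g x = S + sym_outer (f x) x" for x
  have gB: "g ` (- ?R) \<subseteq> off_line T S u"
    using f by (auto simp: g_def off_line_def)
  have fibre: "card {x \<in> - ?R. g x = p} \<le> ?q - 1" for p
  proof (cases "{x \<in> - ?R. g x = p} = {}")
    case False
    then obtain x where x: "x \<notin> ?R" "g x = p" by auto
    have "{x \<in> - ?R. g x = p} \<subseteq> (\<lambda>k. k *s x) ` (- {0})"
    proof
      fix y assume "y \<in> {x \<in> - ?R. g x = p}"
      then have y: "y \<notin> ?R" "g y = p" by auto
      \<comment> \<open>Writing zero as \<open>sym_outer 0 x\<close> turns equality of two rank one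
        matrices into an instance of the proportionality lemma.\<close>
      then have "sym_outer (f y) y - sym_outer (f x) x = sym_outer 0 x"
        using x by (auto simp: g_def)
      then obtain k where "y = k *s x"
        using sym_outer_diff_eq_sym_outer f x y nz by metis
      moreover have "k \<noteq> 0" using nz y calculation by auto
      ultimately show "y \<in> (\<lambda>k. k *s x) ` (- {0})" by blast
    qed
    then have "card {x \<in> - ?R. g x = p} \<le> card (- {0 :: 'a})"
      by (intro surj_card_le) auto
    then show ?thesis by (simp add: Compl_eq_Diff_UNIV card_Diff_singleton)
  next
    case True
    show ?thesis unfolding True by simp
  qed
  have "- ?R = (\<Union>p\<in>g ` (- ?R). {x \<in> - ?R. g x = p})" by auto
  then have "card (- ?R) \<le> (\<Sum>p\<in>g ` (- ?R). card {x \<in> - ?R. g x = p})"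
    using card_UN_le[of "g ` (- ?R)" "\<lambda>p. {x \<in> - ?R. g x = p}"] by simp
  also have "\<dots> \<le> (?q - 1) * card (g ` (- ?R))"
    using sum_bounded_above[of "g ` (- ?R)" "\<lambda>p. card {x \<in> - ?R. g x = p}" "?q - 1"] fibre
    by (simp add: mult.commute)
  also have "\<dots> \<le> (?q - 1) * card (off_line T S u)"
    using gB by (intro mult_left_mono card_mono) auto
  finally have "card (- ?R) \<le> (?q - 1) * card (off_line T S u)" .
  moreover have "card ?R \<le> ?q" by (rule card_image_le) simp
  moreover have "?q ^ CARD('n) = card ?R + card (- ?R)"
    by (subst card_Un_disjoint[symmetric]) auto
  ultimately show ?thesis by linarith
qed

lemma card_stopping_set:
  fixes T :: "('a::{field,finite} ^ 'n::finite ^ 'n) set"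
  assumes T: "stopping_set lines points incidence T" and ne: "T \<noteq> {}"
  shows "2 * (real CARD('a) ^ CARD('n) - 1) / (real CARD('a) - 1) \<le> real (card T)"
proof -
  let ?q = "CARD('a)"
  obtain S where S: "S \<in> T" using ne by blast
  \<comment> \<open>Any nonzero direction would serve; this is the all-ones vector.\<close>
  define u :: "'a ^ 'n" where "u = 1"
  have u: "u \<noteq> 0" by (simp add: u_def vec_eq_iff)
  obtain a where a: "a \<noteq> 0" and S': "S + sym_outer a u \<in> T"
    using stopping_set_meets_line[OF T S u] by blast
  define S' where "S' = S + sym_outer a u"
  let ?B = "off_line T S u" and ?B' = "off_line T S' u"
  \<comment> \<open>A common neighbour of \<open>S\<close> and \<open>S'\<close> lies on their line.
    Since \<open>e\<close> and \<open>y\<close> may be zero, the same fact also keeps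
    \<open>S'\<close> out of \<open>?B\<close> and \<open>S\<close> out of
    \<open>?B'\<close>.\<close>
  have off: False
    if "sym_outer c x = sym_outer d u + sym_outer e y" "c \<noteq> 0" "d \<noteq> 0"
      "x \<notin> range (\<lambda>k. k *s u)" for c d e x and y :: "'a ^ 'n"
  proof -
    have "sym_outer c x - sym_outer d u = sym_outer e y" using that by simp
    from this that(3,2) u obtain k where "x = k *s u"
      by (rule sym_outer_diff_eq_sym_outer)
    then show False using that(4) by blast
  qed
  have S_eq: "S = S' + sym_outer (- a) u" by (simp add: S'_def sym_outer_uminus)
  have SS': "S \<noteq> S'" using a u by (simp add: S'_def sym_outer_eq_0_iff)
  have self: "P \<notin> off_line T P u" for P
  proof
    assume "P \<in> off_line T P u"
    then obtain c x where x: "c \<noteq> 0" "x \<notin> range (\<lambda>k. k *s u)" "sym_outer c x = 0"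
      unfolding off_line_def by auto
    then have "x \<noteq> 0" by (metis rangeI vec.scale_zero_left)
    then show False using x sym_outer_eq_0_iff by blast
  qed
  have "S' \<notin> ?B"
  proof
    assume "S' \<in> ?B"
    then obtain c x where x: "c \<noteq> 0" "x \<notin> range (\<lambda>k. k *s u)" "S' = S + sym_outer c x"
      by (auto simp: off_line_def)
    then have "sym_outer c x = sym_outer a u + sym_outer 0 0" by (simp add: S'_def)
    then show False using off x a by blast
  qed
  moreover have "S \<notin> ?B'"
  proof
    assume "S \<in> ?B'"
    then obtain c x where x: "c \<noteq> 0" "x \<notin> range (\<lambda>k. k *s u)" "S = S' + sym_outer c x"
      by (auto simp: off_line_def)
    then have "sym_outer c x = sym_outer (- a) u + sym_outer 0 0"
      using S_eq by (metis add_left_cancel add.right_neutral sym_outer_zero)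
    moreover have "- a \<noteq> 0" using a by simp
    ultimately show False using off x by blast
  qed
  moreover have "?B \<inter> ?B' = {}"
  proof (rule ccontr)
    assume "?B \<inter> ?B' \<noteq> {}"
    then obtain P where P: "P \<in> ?B" "P \<in> ?B'" by blast
    obtain c x where x: "c \<noteq> 0" "x \<notin> range (\<lambda>k. k *s u)" "P = S + sym_outer c x"
      using P(1) by (auto simp: off_line_def)
    obtain e y where "P = S' + sym_outer e y"
      using P(2) by (auto simp: off_line_def)
    with x have "sym_outer c x = sym_outer a u + sym_outer e y"
      by (simp add: S'_def add.assoc)
    then show False using off x a by blast
  qed
  ultimately have disj: "insert S ?B \<inter> insert S' ?B' = {}"
    using SS' by blast
  have "insert S ?B \<union> insert S' ?B' \<subseteq> T"
    using S S' by (auto simp: off_line_def S'_def)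
  then have "card (insert S ?B) + card (insert S' ?B') \<le> card T"
    by (subst card_Un_disjoint[symmetric]) (auto simp: disj intro: card_mono)
  then have cT: "2 + card ?B + card ?B' \<le> card T"
    by (simp add: self)
  have q: "?q \<ge> 2"
    using card_mono[of UNIV "{0, 1 :: 'a}"] by simp
  have bd: "real ?q ^ CARD('n) \<le> real ?q + (real ?q - 1) * real (card (off_line T P u))"
    if "P \<in> T" for P
  proof -
    have "real (?q ^ CARD('n)) \<le> real (?q + (?q - 1) * card (off_line T P u))"
      using card_off_line[OF T that u] of_nat_le_iff by blast
    then show ?thesis using q by (simp add: of_nat_diff)
  qed
  \<comment> \<open>Each of \<open>S\<close> and \<open>S'\<close> together with its off-line
    neighbours accounts for at least \<open>1 + (N - 1)\<close> points; here this is multiplied by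
    \<open>q - 1\<close>.\<close>
  have "2 * (real ?q ^ CARD('n) - 1) \<le>
      (real ?q - 1) * (2 + real (card ?B) + real (card ?B'))"
    using bd[OF S] bd[of S'] S' by (simp add: S'_def algebra_simps)
  also have "\<dots> \<le> (real ?q - 1) * real (card T)"
    using cT q by (intro mult_left_mono) auto
  finally show ?thesis using q by (simp add: field_simps)
qed

section \<open>Codewords and the final bounds\<close>

lemma stopping_set_support:
  assumes P: "finite P"
    and c: "c \<in> null_space_code R P H" and d: "d \<in> null_space_code R P H"
  shows "stopping_set R P H {p \<in> P. c p \<noteq> d p}"
  unfolding stopping_set_def
proof (intro conjI ballI notI)
  fix r assume r: "r \<in> R" and one: "card {p \<in> {p \<in> P. c p \<noteq> d p}. H r p = 1} = 1"
  have "(\<Sum>p\<in>P. H r p * (c p - d p)) = 0"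
    using c d r unfolding right_diff_distrib sum_subtractf null_space_code_def by simp
  \<comment> \<open>Over the two-element field each term indicates a support position on row
    \<open>r\<close>, so the sum is their number modulo 2; a single one would violate the parity
    check.\<close>
  also have "(\<Sum>p\<in>P. H r p * (c p - d p)) =
      (\<Sum>p\<in>P. if c p \<noteq> d p \<and> H r p = 1 then 1 else 0)"
  proof (rule sum.cong[OF refl])
    fix p
    show "H r p * (c p - d p) = (if c p \<noteq> d p \<and> H r p = 1 then 1 else 0)"
      by (cases "H r p"; cases "c p"; cases "d p") simp_all
  qed
  also have "\<dots> = of_nat (card {p \<in> {p \<in> P. c p \<noteq> d p}. H r p = 1})"
    using P by (simp add: sum.If_cases Int_def conj_assoc)
  finally show False using one by simp
qed auto

lemma stopping_distance_le_minimum_distance: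
  assumes "finite P"
  shows "stopping_distance R P H \<le> minimum_distance P (null_space_code R P H)"
  unfolding minimum_distance_def
proof (rule Inf_greatest, clarify)
  fix c d assume cd: "c \<in> null_space_code R P H" "d \<in> null_space_code R P H" "c \<noteq> d"
  \<comment> \<open>Codewords are extensional functions, so distinct ones differ at a position
    inside \<open>P\<close>.\<close>
  then have "{p \<in> P. c p \<noteq> d p} \<noteq> {}"
    using PiE_ext[of c P "\<lambda>_. UNIV" d] by (auto simp: null_space_code_def)
  moreover have "stopping_set R P H {p \<in> P. c p \<noteq> d p}"
    using stopping_set_support[OF assms cd(1,2)] .
  ultimately show "stopping_distance R P H \<le> enat (hamming_distance P c d)"
    unfolding stopping_distance_def hamming_distance_def by (blast intro: Inf_lower)
qed

theorem theorem4:
  fixes q n :: nat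
    and C :: "('a::{field,finite} ^ 'n::finite ^ 'n \<Rightarrow> bit) set"
  assumes "q = CARD('a)" and "n = CARD('n)" and "C = symmetric_code"
  shows "ereal (2 * (real q ^ n - 1) / (real q - 1)) \<le> ereal_of_enat (minimum_distance points C)
    \<and> ereal (2 * (real q ^ n - 1) / (real q - 1)) \<le>
        ereal_of_enat (stopping_distance (lines :: ('a ^ 'n ^ 'n) set set) points incidence)"
proof -
  let ?b = "2 * (real q ^ n - 1) / (real q - 1)"
  let ?sd = "stopping_distance (lines :: ('a ^ 'n ^ 'n) set set) points incidence"
  \<comment> \<open>Rounding the real bound up loses nothing against cardinalities and lets the
    infimum be bounded within \<open>enat\<close>.\<close>
  have "enat (nat \<lceil>?b\<rceil>) \<le> ?sd"
    unfolding stopping_distance_def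
  proof (rule Inf_greatest, clarify)
    fix T :: "('a ^ 'n ^ 'n) set"
    assume "stopping_set lines points incidence T" "T \<noteq> {}"
    then have "?b \<le> real (card T)" using card_stopping_set assms by blast
    then show "enat (nat \<lceil>?b\<rceil>) \<le> enat (card T)" by (simp add: ceiling_le_iff)
  qed
  then have "ereal_of_enat (enat (nat \<lceil>?b\<rceil>)) \<le> ereal_of_enat ?sd"
    by (simp only: ereal_of_enat_le_iff)
  moreover have "ereal ?b \<le> ereal_of_enat (enat (nat \<lceil>?b\<rceil>))"
    by (simp add: real_nat_ceiling_ge)
  ultimately have sd: "ereal ?b \<le> ereal_of_enat ?sd" by (rule order_trans[rotated])
  have "?sd \<le> minimum_distance points C"
    unfolding assms(3) symmetric_code_def
    by (rule stopping_distance_le_minimum_distance) simp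
  then have "ereal_of_enat ?sd \<le> ereal_of_enat (minimum_distance points C)"
    by (simp only: ereal_of_enat_le_iff)
  with sd show ?thesis by (blast intro: order_trans)
qed

end
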